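(* (1) $LB\circ B\subseteq B$ and $LB\circ LB\subseteq LB$. (2) $B\circ DB\subseteq B$ and $DB\circ DB\subseteq DB$. Here $B$, $LB$, $DB$ denote the classes of bottom-up, linear bottom-up, and deterministic bottom-up tree transformations, and in $F\circ G$ the transformation from $F$ is applied first.
   Context: Alphabets are finite. A ranked alphabet $\Sigma$ is a finite set of symbols with, for each $k\ge 0$, a subset $\Sigma_k$ (symbols of rank $k$; a symbol may have several ranks), $\Sigma=\bigcup_k\Sigma_k$, only finitely many $\Sigma_k$ nonempty. $T_\Sigma$ is the set of trees over $\Sigma$: $a\in T_\Sigma$ for $a\in\Sigma_0$, and $a[t_1\cdots t_k]\in T_\Sigma$ for $k\ge1$, $a\in\Sigma_k$, $t_i\in T_\Sigma$. A tree transformation from $T_\Sigma$ into $T_\Delta$ is a subset of $T_\Sigma\times T_\Delta$. For $M_1\subseteq T_\Sigma\times T_\Delta$ and $M_2\subseteq T_\Delta\times T_\Omega$, $M_1\circ M_2=\{(s,t)\mid (s,u)\in M_1,(u,t)\in M_2\text{ for some }u\in T_\Delta\}$; $F\circ G=\{M_1\circ M_2\mid M_1\in F,M_2\in G\}$. Variables: $X_k=\{x_1,\dots,x_k\}$; $T_\Delta(X_k)$ is the set of trees over $\Delta\cup X_k$, variables having rank $0$. A bottom-up finite tree transducer is $M=(Q,\Sigma,\Delta,R,Q_d)$, where $Q$ is a finite set of states, regarded as symbols of rank $1$ only and disjoint from $\Sigma\cup\Delta$, $Q_d\subseteq Q$ (final states), and $R$ is a finite set of rules of the forms $a\to q[t]$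 ($a\in\Sigma_0$, $q\in Q$, $t\in T_\Delta$) or $a[q_1[x_1]\cdots q_k[x_k]]\to q[t]$ ($k\ge1$, $a\in\Sigma_k$, $q_i,q\in Q$, $t\in T_\Delta(X_k)$). Rules rewrite trees over $Q\cup\Sigma\cup\Delta$: $s\Rightarrow s'$ if $s'$ is obtained from $s$ by replacing one occurrence of a subtree $v\langle x_1\gets\phi_1,\dots,x_k\gets\phi_k\rangle$ by $w\langle x_1\gets\phi_1,\dots,x_k\gets\phi_k\rangle$ for a rule $v\to w$ and some $\phi_i\in T_\Delta$ (simultaneous substitution). $M$ realizes $\{(s,t)\in T_\Sigma\times T_\Delta\mid s\Rightarrow^*q[t]\text{ for some }q\in Q_d\}$. $M$ is linear if no variable occurs more than once in the right hand side of a rule; $M$ is (partial) deterministic if different rules have different left hand sides. $B$, $LB$, $DB$ are the classes of tree transformations realized by arbitrary, linear, and deterministic bottom-up finite tree transducers respectively. *)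

theory Defs
  imports Main "HOL-Library.Infinite_Typeclass"
begin

text \<open>
  All symbols (input and output symbols as well as states) are drawn from one type
  \<open>'a\<close>, so that an input and an output alphabet may share symbols.
  The variable \<open>x\<^sub>i\<close> is \<open>Var i\<close> (numbered from 1), and the tree consisting
  of the single symbol \<open>a\<close> is \<open>Node a []\<close>.
\<close>

datatype 'a tree = Var nat | Node 'a "'a tree list"

type_synonym 'a transformation = "('a tree \<times> 'a tree) set"

text \<open>\<open>S k\<close> is the set of symbols of rank \<open>k\<close>; these sets may overlap.\<close>

type_synonym 'a ranked = "nat \<Rightarrow> 'a set"

definition symbols :: "'a ranked \<Rightarrow> 'a set" where
  "symbols S = (\<Union>k. S k)"

definition ranked_alphabet :: "'a ranked \<Rightarrow> bool" where
  "ranked_alphabet S \<longleftrightarrow> finite (symbols S) \<and> finite {k. S k \<noteq> {}}"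

text \<open>\<open>trees_over S k\<close> is the set of trees over \<open>S\<close> and the variables
  \<open>x\<^sub>1, \<dots>, x\<^sub>k\<close>.\<close>

inductive_set trees_over :: "'a ranked \<Rightarrow> nat \<Rightarrow> 'a tree set"
  for S :: "'a ranked" and k :: nat
where
  "\<lbrakk>1 \<le> i; i \<le> k\<rbrakk> \<Longrightarrow> Var i \<in> trees_over S k"
| "\<lbrakk>a \<in> S (length ts); \<forall>t \<in> set ts. t \<in> trees_over S k\<rbrakk> \<Longrightarrow> Node a ts \<in> trees_over S k"

abbreviation trees :: "'a ranked \<Rightarrow> 'a tree set" where
  "trees S \<equiv> trees_over S 0"

text \<open>The list of all variable occurrences, with repetitions.\<close>

fun var_list :: "'a tree \<Rightarrow> nat list" where
  "var_list (Var i) = [i]"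
| "var_list (Node a ts) = concat (map var_list ts)"

fun subst :: "(nat \<Rightarrow> 'a tree) \<Rightarrow> 'a tree \<Rightarrow> 'a tree" where
  "subst \<phi> (Var i) = \<phi> i"
| "subst \<phi> (Node a ts) = Node a (map (subst \<phi>) ts)"

record 'a transducer =
  states :: "'a set"
  in_alph :: "'a ranked"
  out_alph :: "'a ranked"
  rules :: "('a tree \<times> 'a tree) set"
  final :: "'a set"

text \<open>The left hand side \<open>a[q\<^sub>1[x\<^sub>1] \<dots> q\<^sub>k[x\<^sub>k]]\<close>, which for \<open>k = 0\<close> is just \<open>a\<close>.\<close>

definition lhs :: "'a \<Rightarrow> 'a list \<Rightarrow> 'a tree" where
  "lhs a qs = Node a (map (\<lambda>i. Node (qs ! i) [Var (Suc i)]) [0..<length qs])"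

definition bottom_up :: "'a transducer \<Rightarrow> bool" where
  "bottom_up M \<longleftrightarrow>
     ranked_alphabet (in_alph M) \<and> ranked_alphabet (out_alph M) \<and>
     finite (states M) \<and>
     states M \<inter> (symbols (in_alph M) \<union> symbols (out_alph M)) = {} \<and>
     final M \<subseteq> states M \<and>
     finite (rules M) \<and>
     rules M \<subseteq> {(lhs a qs, Node q [t]) | a qs q t.
        a \<in> in_alph M (length qs) \<and> set qs \<subseteq> states M \<and> q \<in> states M \<and>
        t \<in> trees_over (out_alph M) (length qs)}"

definition linear :: "'a transducer \<Rightarrow> bool" where
  "linear M \<longleftrightarrow> (\<forall>(v, w) \<in> rules M. distinct (var_list w))"

definition deterministic :: "'a transducer \<Rightarrow> bool" where
  "deterministic M \<longleftrightarrow>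
     (\<forall>r \<in> rules M. \<forall>r' \<in> rules M. r \<noteq> r' \<longrightarrow> fst r \<noteq> fst r')"

text \<open>
  One rewriting step. The variables of \<open>v\<close> are exactly \<open>x\<^sub>1, \<dots>, x\<^sub>k\<close> and include those
  of \<open>w\<close>, so \<open>\<phi>\<close> is constrained on them only. The relation is not
  restricted to trees over states, input and output symbols, but it preserves that set.
\<close>

inductive step :: "'a transducer \<Rightarrow> 'a tree \<Rightarrow> 'a tree \<Rightarrow> bool"
  for M :: "'a transducer"
where
  "\<lbrakk>(v, w) \<in> rules M; \<forall>i \<in> set (var_list v). \<phi> i \<in> trees (out_alph M)\<rbrakk>
    \<Longrightarrow> step M (subst \<phi> v) (subst \<phi> w)"
| "step M s s' \<Longrightarrow> step M (Node a (ls @ s # rs)) (Node a (ls @ s' # rs))"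

definition realized :: "'a transducer \<Rightarrow> 'a transformation" where
  "realized M = {(s, t). s \<in> trees (in_alph M) \<and> t \<in> trees (out_alph M) \<and>
     (\<exists>q \<in> final M. (step M)\<^sup>*\<^sup>* s (Node q [t]))}"

definition B :: "'a transformation set" where
  "B = {realized M | M. bottom_up M}"

definition LB :: "'a transformation set" where
  "LB = {realized M | M. bottom_up M \<and> linear M}"

definition DB :: "'a transformation set" where
  "DB = {realized M | M. bottom_up M \<and> deterministic M}"

text \<open>
  The transformation from \<open>F\<close> is applied first. No common middle alphabet is
  demanded: two transformations between trees over ranked alphabets always have one, namely
  the union of the output alphabet of the first and the input alphabet of the second.
\<close>

definition compose_classes ::
  "'a transformation set \<Rightarrow> 'a transformation set \<Rightarrow> 'a transformation set"
  (infixr "\<odot>" 75) where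
  "F \<odot> G = {M1 O M2 | M1 M2. M1 \<in> F \<and> M2 \<in> G}"

end

theory Submission
  imports Defs "HOL-Library.FuncSet"
begin

text \<open>
  A product construction: on an input tree \<open>s\<close> the composite transducer guesses an output \<open>u\<close> of
  the first transducer together with a run of the second one on \<open>u\<close>, so its rules are obtained by
  running the second transducer on right hand sides of the first. This is complete if every
  intermediate subtree is translated in only one way: by linearity of the first transducer it is
  used at most once, or by determinism of the second one all its copies are treated alike. A deleted
  intermediate subtree need not be translatable at all; an extra state records this. Using that
  state only when no translation exists keeps the composite of deterministic transducers
  deterministic.
\<close>

section \<open>Substitution, variable occurrences and the shape of rules\<close>

lemma subst_subst: "subst f (subst g t) = subst (\<lambda>i. subst f (g i)) t"
  by (induction t) auto

lemma subst_cong: "(\<And>i. i \<in> set (var_list t) \<Longrightarrow> f i = g i) \<Longrightarrow> subst f t = subst g t"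
  by (induction t) auto

lemma var_list_subst: "var_list (subst f t) = concat (map (\<lambda>i. var_list (f i)) (var_list t))"
proof (induction t)
  case (Node a ts)
  then show ?case by (induction ts) auto
qed auto

lemma var_list_trees_over: "t \<in> trees_over S k \<Longrightarrow> set (var_list t) \<subseteq> {1..k}"
  by (induction rule: trees_over.induct) auto

lemma subst_trees_over:
  assumes "t \<in> trees_over S k" "\<And>i. 1 \<le> i \<Longrightarrow> i \<le> k \<Longrightarrow> f i \<in> trees_over S m"
  shows "subst f t \<in> trees_over S m"
  using assms by (induction rule: trees_over.induct) (auto intro!: trees_over.intros)

lemma trees_over_mono:
  assumes "t \<in> trees_over S k" "\<And>n. S n \<subseteq> S' n"
  shows "t \<in> trees_over S' k"
  using assms by (induction rule: trees_over.induct) (auto intro!: trees_over.intros)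

lemma trees_over_Node_iff:
  "Node a ts \<in> trees_over S k \<longleftrightarrow> a \<in> S (length ts) \<and> (\<forall>t \<in> set ts. t \<in> trees_over S k)"
  by (auto elim: trees_over.cases intro: trees_over.intros)

lemma in_symbols: "a \<in> S k \<Longrightarrow> a \<in> symbols S"
  by (auto simp: symbols_def)

text \<open>Determinism compares left hand sides as trees; this turns equal trees into equal symbols
  and equal state lists.\<close>

lemma lhs_eq_iff: "lhs a qs = lhs b ps \<longleftrightarrow> a = b \<and> qs = ps"
proof
  assume eq: "lhs a qs = lhs b ps"
  have len: "length qs = length ps"
    using arg_cong[OF eq, of "\<lambda>t. case t of Node _ ts \<Rightarrow> length ts"] by (simp add: lhs_def)
  have "qs ! i = ps ! i" if "i < length qs" for i
    using eq that len by (simp add: lhs_def)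
  then show "a = b \<and> qs = ps"
    using eq len nth_equalityI[OF len] by (simp add: lhs_def)
qed auto

lemma var_list_lhs: "set (var_list (lhs a qs)) = {1..length qs}"
proof (rule set_eqI)
  fix i
  show "i \<in> set (var_list (lhs a qs)) \<longleftrightarrow> i \<in> {1..length qs}"
    by (cases i) (auto simp: lhs_def)
qed

lemma subst_lhs:
  "subst f (lhs a qs) = Node a (map (\<lambda>i. Node (qs ! i) [f (Suc i)]) [0..<length qs])"
  by (simp add: lhs_def)

lemma bottom_up_ruleE:
  assumes "bottom_up M" "(v, x) \<in> rules M"
  obtains a qs q w where "v = lhs a qs" "x = Node q [w]"
  using assms unfolding bottom_up_def by blast

lemma bottom_up_ruleD:
  assumes "bottom_up M" "(lhs a qs, Node q [w]) \<in> rules M"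
  shows "a \<in> in_alph M (length qs)" "set qs \<subseteq> states M" "q \<in> states M"
    "w \<in> trees_over (out_alph M) (length qs)"
proof -
  obtain b ps p t where "lhs a qs = lhs b ps" "Node q [w] = Node p [t]"
    "b \<in> in_alph M (length ps)" "set ps \<subseteq> states M" "p \<in> states M"
    "t \<in> trees_over (out_alph M) (length ps)"
    using assms unfolding bottom_up_def by blast
  then show "a \<in> in_alph M (length qs)" "set qs \<subseteq> states M" "q \<in> states M"
    "w \<in> trees_over (out_alph M) (length qs)"
    by (auto simp: lhs_eq_iff)
qed

lemma rule_vars:
  assumes "bottom_up M" "(lhs a qs, Node q [w]) \<in> rules M" "i \<in> set (var_list w)"
  obtains j where "i = Suc j" "j < length qs"
proof -
  have "i \<in> {1..length qs}"
    using var_list_trees_over[OF bottom_up_ruleD(4)[OF assms(1,2)]] assms(3) by blast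
  then show thesis using that[of "i - 1"] by auto
qed

lemma state_not_symbol:
  assumes "bottom_up M" "q \<in> states M"
  shows "q \<notin> in_alph M k" "q \<notin> out_alph M k"
  using assms in_symbols[of q] unfolding bottom_up_def by blast+


subsection \<open>Runs\<close>

text \<open>\<open>A i q t\<close> allows the variable \<open>x\<^sub>i\<close> to be read in state \<open>q\<close> with output \<open>t\<close>.\<close>

inductive run :: "'a transducer \<Rightarrow> (nat \<Rightarrow> 'a \<Rightarrow> 'a tree \<Rightarrow> bool) \<Rightarrow> 'a tree \<Rightarrow> 'a \<Rightarrow> 'a tree \<Rightarrow> bool"
  for M A
where
  run_Var: "A i q t \<Longrightarrow> run M A (Var i) q t"
| run_Node: "\<lbrakk>(lhs a qs, Node q [w]) \<in> rules M; length qs = length ss;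
    \<And>i. i < length ss \<Longrightarrow> run M A (ss ! i) (qs ! i) (f (Suc i))\<rbrakk>
    \<Longrightarrow> run M A (Node a ss) q (subst f w)"

inductive_cases run_VarE: "run M A (Var i) q t"
inductive_cases run_NodeE: "run M A (Node a ss) q t"

abbreviation closed_run :: "'a transducer \<Rightarrow> 'a tree \<Rightarrow> 'a \<Rightarrow> 'a tree \<Rightarrow> bool" where
  "closed_run M \<equiv> run M (\<lambda>_ _ _. False)"

section \<open>States, inputs and outputs of runs\<close>

lemma run_cong:
  assumes "run M A s q t" "\<And>i r u. i \<in> set (var_list s) \<Longrightarrow> A i r u \<Longrightarrow> A' i r u"
  shows "run M A' s q t"
  using assms
proof (induction rule: run.induct)
  case (run_Node a qs q w ss f)
  show ?case
    using run_Node.hyps(1,2)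
  proof (rule run.run_Node)
    fix i assume "i < length ss"
    then have "set (var_list (ss ! i)) \<subseteq> set (var_list (Node a ss))"
      by (auto intro: nth_mem)
    with \<open>i < length ss\<close> show "run M A' (ss ! i) (qs ! i) (f (Suc i))"
      using run_Node.prems by (intro run_Node.IH) blast+
  qed
qed (auto intro: run.intros)

lemma run_state:
  assumes "bottom_up M" "run M A s q t" "\<And>i r u. A i r u \<Longrightarrow> r \<in> states M"
  shows "q \<in> states M"
  using assms(2,3) by cases (auto dest: bottom_up_ruleD(3)[OF assms(1)])

lemma run_output:
  assumes "bottom_up M" "run M A s q t" "\<And>i r u. A i r u \<Longrightarrow> u \<in> trees_over (out_alph M) k"
  shows "t \<in> trees_over (out_alph M) k"
  using assms(2)
proof (induction rule: run.induct)
  case (run_Node a qs q w ss f)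
  show ?case
    using bottom_up_ruleD(4)[OF assms(1) run_Node.hyps(1)]
  proof (rule subst_trees_over)
    fix i assume "1 \<le> i" "i \<le> length qs"
    then show "f i \<in> trees_over (out_alph M) k"
      using run_Node.IH[of "i - 1"] run_Node.hyps(2) by simp
  qed
qed (rule assms(3))

lemma closed_run_input:
  assumes "bottom_up M" "closed_run M s q t"
  shows "s \<in> trees (in_alph M)"
  using assms(2)
proof (induction rule: run.induct)
  case (run_Node a qs q w ss f)
  then show ?case
    using bottom_up_ruleD(1)[OF assms(1) run_Node.hyps(1)]
    by (auto simp: trees_over_Node_iff in_set_conv_nth)
qed simp

lemma run_vars:
  assumes "bottom_up M" "run M A s q t" "\<And>i r u. A i r u \<Longrightarrow> u = Var i"
  shows "set (var_list t) \<subseteq> set (var_list s)"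
  using assms(2)
proof (induction rule: run.induct)
  case (run_Node a qs q w ss f)
  show ?case
  proof
    fix v assume "v \<in> set (var_list (subst f w))"
    then obtain i where i: "i \<in> set (var_list w)" "v \<in> set (var_list (f i))"
      by (auto simp: var_list_subst)
    obtain j where "i = Suc j" "j < length ss"
      using rule_vars[OF assms(1) run_Node.hyps(1) i(1)] run_Node.hyps(2) by metis
    with i(2) run_Node.IH[of j] have "v \<in> set (var_list (ss ! j))" "ss ! j \<in> set ss" by auto
    then show "v \<in> set (var_list (Node a ss))" by auto
  qed
qed (auto dest: assms(3))

text \<open>Bottom-up, the states reached at the children fix the left hand side, and in a
  deterministic transducer that fixes the rule. At the leaves \<open>A\<close> has to be
  functional.\<close>

lemma run_functional:
  assumes "bottom_up M" "deterministic M" "run M A s q t" "run M A s q' t'"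
    and A: "\<And>i r u r' u'. A i r u \<Longrightarrow> A i r' u' \<Longrightarrow> r = r' \<and> u = u'"
  shows "q = q' \<and> t = t'"
  using assms(3,4)
proof (induction arbitrary: q' t' rule: run.induct)
  case (run_Var i q t)
  then show ?case using A by (auto elim: run_VarE)
next
  case (run_Node a qs q w ss f)
  from run_Node.prems obtain qs' w' f' where *: "t' = subst f' w'"
    "(lhs a qs', Node q' [w']) \<in> rules M" "length qs' = length ss"
    "\<And>i. i < length ss \<Longrightarrow> run M A (ss ! i) (qs' ! i) (f' (Suc i))"
    by (auto elim: run_NodeE)
  have eq: "qs ! i = qs' ! i \<and> f (Suc i) = f' (Suc i)" if "i < length ss" for i
 using run_Node.IH[OF that *(4)[OF that]] .
  then have "qs = qs'" using * run_Node.hyps(2) by (auto intro: nth_equalityI)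
  then have "q = q'" "w = w'"
    using * run_Node.hyps(1) assms(2) unfolding deterministic_def by fastforce+
  \<comment> \<open>The total functions \<open>f\<close> and \<open>f'\<close> may differ elsewhere,
    but agree on the variables of \<open>w\<close>.\<close>
  moreover have "subst f w = subst f' w"
    by (rule subst_cong) (metis rule_vars[OF assms(1) run_Node.hyps(1)] eq run_Node.hyps(2))
  ultimately show ?case using * by simp
qed

text \<open>At a node there are finitely many rules and finitely many outputs for each child. This
  will make the rule set of the composite finite.\<close>

lemma finite_run:
  assumes "bottom_up M" and A: "\<And>i. finite {(q, t). A i q t}"
  shows "finite {(q, t). run M A s q t}"
proof (induction s)
  case (Var i)
  have "{(q, t). run M A (Var i) q t} = {(q, t). A i q t}"
    by (auto elim: run_VarE intro: run.intros)
  then show ?case using A by simp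
next
  case (Node a ss)
  \<comment> \<open>Only finitely many functions remain once \<open>f\<close> is restricted to the
    child positions; the variable numbered \<open>i\<close> belongs to the child with list index
    \<open>i - 1\<close>.\<close>
  let ?F = "PiE {1..length ss} (\<lambda>i. snd ` {(q, t). run M A (ss ! (i - 1)) q t})"
  let ?out = "\<lambda>x f. case x of Node q [w] \<Rightarrow> (q, subst f w)"
  have "{(q, t). run M A (Node a ss) q t} \<subseteq> (\<Union>x \<in> snd ` rules M. ?out x ` ?F)"
  proof clarify
    fix q t assume "run M A (Node a ss) q t"
    then obtain qs w f where *: "t = subst f w" "(lhs a qs, Node q [w]) \<in> rules M"
      "length qs = length ss" "\<And>i. i < length ss \<Longrightarrow> run M A (ss ! i) (qs ! i) (f (Suc i))"
      by (auto elim: run_NodeE)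
    let ?f = "restrict f {1..length ss}"
    have "?f \<in> ?F"
    proof (rule restrict_PiE_iff[THEN iffD2], rule ballI)
      fix i assume "i \<in> {1..length ss}"
      then have "i - 1 < length ss" "Suc (i - 1) = i" by auto
      then have "run M A (ss ! (i - 1)) (qs ! (i - 1)) (f i)" using *(4)[of "i - 1"] by metis
      then show "f i \<in> snd ` {(q, t). run M A (ss ! (i - 1)) q t}" by force
    qed
    moreover have "t = subst ?f w"
      unfolding *(1)
    proof (rule subst_cong)
      fix i assume "i \<in> set (var_list w)"
      then show "f i = ?f i" using *(3) by (auto elim: rule_vars[OF assms(1) *(2)])
    qed
    ultimately show "(q, t) \<in> (\<Union>x \<in> snd ` rules M. ?out x ` ?F)"
      using *(1,2) \<open>t = subst ?f w\<close>
      by (intro UN_I[of "Node q [w]"] image_eqI[of _ _ ?f]) (auto intro: rev_image_eqI)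
  qed
  moreover have "finite ?F"
    using Node by (intro finite_PiE) auto
  moreover have "finite (rules M)"
    using assms(1) by (simp add: bottom_up_def)
  ultimately show ?case by (meson finite_UN_I finite_imageI finite_subset)
qed

section \<open>Linear trees and linear transducers\<close>

lemma disjoint_var_lists:
  assumes "distinct (concat (map h xs))" "i < length xs" "j < length xs" "i \<noteq> j"
  shows "set (h (xs ! i)) \<inter> set (h (xs ! j)) = {}"
  using assms
proof (induction xs arbitrary: i j)
  case (Cons x xs)
  have "set (h (xs ! k)) \<inter> set (h x) = {}" if "k < length xs" for k
    using Cons.prems(1) nth_mem[OF that] by auto
  with Cons show ?case by (cases i; cases j) (auto simp: Int_commute)
qed simp

lemma distinct_concat_map:
  assumes "distinct xs" "\<And>x. x \<in> set xs \<Longrightarrow> distinct (h x)"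
    "\<And>x y. x \<in> set xs \<Longrightarrow> y \<in> set xs \<Longrightarrow> x \<noteq> y \<Longrightarrow> set (h x) \<inter> set (h y) = {}"
  shows "distinct (concat (map h xs))"
  using assms by (induction xs) fastforce+

text \<open>The output for a child contains only variables of that child. Children of a linear tree
  share no variables, and a linear right hand side uses each child's output at most once.\<close>

lemma run_linear:
  assumes "bottom_up M" "linear M" "run M A s q t" "distinct (var_list s)"
    and A: "\<And>i r u. A i r u \<Longrightarrow> u = Var i"
  shows "distinct (var_list t)"
  using assms(3,4)
proof (induction rule: run.induct)
  case (run_Var i q t)
  then show ?case using A by auto
next
  case (run_Node a qs q w ss f)
  note rv = rule_vars[OF assms(1) run_Node.hyps(1), unfolded run_Node.hyps(2)]
  have d: "distinct (concat (map var_list ss))" using run_Node.prems by simp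
  show ?case
    unfolding var_list_subst
  proof (rule distinct_concat_map)
    show "distinct (var_list w)"
      using assms(2) run_Node.hyps(1) unfolding linear_def by fastforce
  next
    fix i assume "i \<in> set (var_list w)"
    then obtain j where "i = Suc j" "j < length ss" by (rule rv)
    moreover have "distinct (var_list (ss ! j))"
      using d nth_mem[OF \<open>j < length ss\<close>] by (simp add: distinct_concat_iff)
    ultimately show "distinct (var_list (f i))" using run_Node.IH[of j] by simp
  next
    fix i i' assume i: "i \<in> set (var_list w)" "i' \<in> set (var_list w)" "i \<noteq> i'"
    obtain j where j: "i = Suc j" "j < length ss" using i(1) by (rule rv)
    obtain j' where j': "i' = Suc j'" "j' < length ss" using i(2) by (rule rv)
    have "set (var_list (ss ! j)) \<inter> set (var_list (ss ! j')) = {}"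
      using i(3) j j' by (intro disjoint_var_lists[OF d]) auto
    moreover have "set (var_list (f (Suc k))) \<subseteq> set (var_list (ss ! k))" if "k < length ss" for k
      using run_vars[OF assms(1) run_Node.hyps(3)[OF that]] A by simp
    ultimately show "set (var_list (f i)) \<inter> set (var_list (f i')) = {}"
      using j j' by blast
  qed
qed

text \<open>Runs compose: each leaf read through \<open>A\<close> is replaced by an actual run on
  the tree put there.\<close>

lemma run_subst:
  assumes "run M A s q t" "\<And>i r u. A i r u \<Longrightarrow> run M A' (g i) r (subst h u)"
  shows "run M A' (subst g s) q (subst h t)"
  using assms(1)
proof (induction rule: run.induct)
  case (run_Node a qs q w ss f)
  show ?case
    unfolding subst_subst subst.simps using run_Node by (intro run.run_Node) auto
qed (simp add: assms(2))

text \<open>A run on \<open>subst g s\<close> may treat two copies of \<open>g i\<close> differently. Either hypothesis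
  excludes this, so that the run restricts to one run on each \<open>g i\<close>.\<close>

lemma run_substE:
  assumes "bottom_up M" "run M A (subst g s) q t"
    and "distinct (var_list s) \<or>
      (\<forall>i r u r' u'. run M A (g i) r u \<longrightarrow> run M A (g i) r' u' \<longrightarrow> r = r' \<and> u = u')"
  shows "\<exists>p h t'. (\<forall>i \<in> set (var_list s). run M A (g i) (p i) (h i)) \<and>
    run M (\<lambda>i r u. r = p i \<and> u = Var i) s q t' \<and> t = subst h t'"
  using assms(2,3)
proof (induction s arbitrary: q t)
  case (Var i)
  then show ?case
    by (intro exI[of _ "\<lambda>_. q"] exI[of _ "\<lambda>_. t"] exI[of _ "Var i"]) (auto intro: run.intros)
next
  case (Node a ss)
  from Node.prems(1) obtain qs w f where *: "t = subst f w" "(lhs a qs, Node q [w]) \<in> rules M"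
    "length qs = length ss"
    "\<And>i. i < length ss \<Longrightarrow> run M A (subst g (ss ! i)) (qs ! i) (f (Suc i))"
    by (auto elim: run_NodeE)
  define reads :: "(nat \<Rightarrow> 'a) \<Rightarrow> nat \<Rightarrow> 'a \<Rightarrow> 'a tree \<Rightarrow> bool"
    where "reads p = (\<lambda>i r u. r = p i \<and> u = Var i)" for p
  have "\<exists>p h t'. (\<forall>i \<in> set (var_list (ss ! j)). run M A (g i) (p i) (h i)) \<and>
      run M (reads p) (ss ! j) (qs ! j) t' \<and> f (Suc j) = subst h t'"
    if "j < length ss" for j
    unfolding reads_def
  proof (rule Node.IH)
    show "ss ! j \<in> set ss" using that by simp
    show "run M A (subst g (ss ! j)) (qs ! j) (f (Suc j))" using that by (rule *(4))
    show "distinct (var_list (ss ! j)) \<or>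
        (\<forall>i r u r' u'. run M A (g i) r u \<longrightarrow> run M A (g i) r' u' \<longrightarrow> r = r' \<and> u = u')"
      using Node.prems(2) nth_mem[OF that] unfolding var_list.simps distinct_concat_iff by fastforce
  qed
  \<comment> \<open>The induction hypothesis yields states \<open>P j\<close> and outputs
    \<open>H j\<close> separately for each child \<open>j\<close>; they still have to be
    merged.\<close>
  then obtain P H T where PHT:
    "\<And>j i. j < length ss \<Longrightarrow> i \<in> set (var_list (ss ! j)) \<Longrightarrow> run M A (g i) (P j i) (H j i)"
    "\<And>j. j < length ss \<Longrightarrow> run M (reads (P j)) (ss ! j) (qs ! j) (T j)"
    "\<And>j. j < length ss \<Longrightarrow> f (Suc j) = subst (H j) (T j)"
    by metis
  \<comment> \<open>Any child containing the variable will do. In a linear tree there is just one;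
    otherwise both choices come from runs on the same \<open>g i\<close>, which agree by the
    functionality hypothesis.\<close>
  define J where "J i = (SOME j. j < length ss \<and> i \<in> set (var_list (ss ! j)))" for i
  define p where "p i = P (J i) i" for i
  define h where "h i = H (J i) i" for i
  have ph: "p i = P j i \<and> h i = H j i" if "j < length ss" "i \<in> set (var_list (ss ! j))" for i j
  proof -
    have J: "J i < length ss" "i \<in> set (var_list (ss ! J i))"
      using someI[of "\<lambda>j. j < length ss \<and> i \<in> set (var_list (ss ! j))" j] that
      by (auto simp: J_def)
    show ?thesis
    proof (cases "distinct (var_list (Node a ss))")
      case True
      then have "J i = j" using disjoint_var_lists[of var_list ss "J i" j] J that by auto
      then show ?thesis by (simp add: p_def h_def)
    next
      case False
      then show ?thesis
        using Node.prems(2) PHT(1)[OF J] PHT(1)[OF that] unfolding p_def h_def by blast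
    qed
  qed
  \<comment> \<open>Shifts child indices, which start at 0, to variable numbers, which start at
    1.\<close>
  let ?T = "\<lambda>i. T (i - 1)"
  have "run M A (g i) (p i) (h i)" if i: "i \<in> set (var_list (Node a ss))" for i
  proof -
    obtain j where j: "j < length ss" "i \<in> set (var_list (ss ! j))"
      using i by (auto simp: in_set_conv_nth[of _ ss])
    then show ?thesis using PHT(1)[OF j] ph[OF j] by simp
  qed
  moreover have "run M (reads p) (Node a ss) q (subst ?T w)"
    using *(2,3)
  proof (rule run_Node)
    fix j assume j: "j < length ss"
    have "run M (reads p) (ss ! j) (qs ! j) (T j)"
      using PHT(2)[OF j] by (rule run_cong) (simp add: reads_def ph[OF j])
    then show "run M (reads p) (ss ! j) (qs ! j) (?T (Suc j))" by simp
  qed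
  moreover have "t = subst h (subst ?T w)"
    unfolding *(1) subst_subst
  proof (rule subst_cong)
    fix i assume "i \<in> set (var_list w)"
    then obtain j where j: "i = Suc j" "j < length ss"
      using rule_vars[OF assms(1) *(2)] *(3) by metis
    have "subst (H j) (T j) = subst h (T j)"
      using run_vars[OF assms(1) PHT(2)[OF j(2)]] ph[OF j(2)]
      by (intro subst_cong) (auto simp: reads_def)
    then show "f i = subst h (?T i)" using PHT(3) j by simp
  qed
  ultimately show ?case unfolding reads_def by blast
qed


subsection \<open>Runs and rewriting\<close>

text \<open>The sentential forms from which \<open>q[t]\<close> is derivable. Input and output symbols may coincide,
  so a derivation may also rewrite inside output trees, but it then ends with nested states.\<close>

inductive completes :: "'a transducer \<Rightarrow> 'a tree \<Rightarrow> 'a \<Rightarrow> 'a tree \<Rightarrow> bool"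
  for M
where
  completes_state: "\<lbrakk>q \<in> states M; t \<in> trees (out_alph M)\<rbrakk> \<Longrightarrow> completes M (Node q [t]) q t"
| completes_rule: "\<lbrakk>(lhs a qs, Node q [w]) \<in> rules M; length qs = length ss;
    \<And>i. i < length ss \<Longrightarrow> completes M (ss ! i) (qs ! i) (f (Suc i))\<rbrakk>
    \<Longrightarrow> completes M (Node a ss) q (subst f w)"

text \<open>Every step leaves a state in the tree, and states are not output symbols.\<close>

lemma step_not_output:
  assumes "bottom_up M" "step M s s'"
  shows "s' \<notin> trees (out_alph M)"
  using assms(2)
proof (induction rule: step.induct)
  case (1 v w f)
  then obtain a qs q t where "v = lhs a qs" "w = Node q [t]"
    using bottom_up_ruleE[OF assms(1)] by metis
  then show ?case
    using 1 bottom_up_ruleD(3)[OF assms(1)] state_not_symbol[OF assms(1)]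
    by (auto simp: trees_over_Node_iff)
qed (auto simp: trees_over_Node_iff)

text \<open>Closure under backward steps lets a derivation be read from its end, whatever the order
  of its steps.\<close>

lemma completes_step:
  assumes "bottom_up M" "step M s s'" "completes M s' q t"
  shows "completes M s q t"
  using assms(2,3)
proof (induction arbitrary: q t rule: step.induct)
  case (1 v w f)
  then obtain a qs p r where r: "v = lhs a qs" "w = Node p [r]" "(lhs a qs, Node p [r]) \<in> rules M"
    using bottom_up_ruleE[OF assms(1)] by metis
  note D = bottom_up_ruleD[OF assms(1) r(3)]
  \<comment> \<open>The root of the rewritten tree is the state \<open>p\<close>. It is not an input
    symbol, so \<open>completes_rule\<close> cannot apply.\<close>
  from 1(3) have "q = p \<and> t = subst f r"
  proof cases
    case (completes_rule a' qs' w' ss f')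
    then show ?thesis
      using r(2) bottom_up_ruleD(1)[OF assms(1) completes_rule(3)] D(3)
        state_not_symbol(1)[OF assms(1)] by auto
  qed (use r in auto)
  moreover have "completes M (subst f v) p (subst f r)"
    unfolding r(1) subst_lhs using 1(2) D r
    by (intro completes_rule[OF r(3)]) (auto simp: var_list_lhs intro!: completes_state)
  ultimately show ?case using r(2) by simp
next
  case (2 s s' a ls rs)
  from 2(3) show ?case
  proof cases
    case completes_state
    \<comment> \<open>The step would have taken place inside the finished output \<open>t\<close>,
      and a step never ends in an output tree.\<close>
    then have "s' = t" by (cases ls) auto
    then show ?thesis using completes_state step_not_output[OF assms(1) 2(1)] by blast
  next
    case (completes_rule qs w f)
    have "completes M ((ls @ s # rs) ! i) (qs ! i) (f (Suc i))" if "i < length (ls @ s # rs)" for i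
      using completes_rule(4)[of i] that 2(2)[of "qs ! i" "f (Suc i)"]
      by (cases "i = length ls") (auto simp: nth_append nth_Cons split: nat.splits)
    then show ?thesis
      unfolding completes_rule(1) using completes_rule by (intro completes.completes_rule) auto
  qed
qed

text \<open>An input tree contains no state, so \<open>completes_state\<close> never applies and
  only rule applications remain.\<close>

lemma completes_run:
  assumes "bottom_up M" "completes M s q t" "s \<in> trees (in_alph M)"
  shows "closed_run M s q t"
  using assms(2,3)
proof (induction rule: completes.induct)
  case (completes_state q t)
  then show ?case
    using state_not_symbol[OF assms(1)] by (auto simp: trees_over_Node_iff)
next
  case (completes_rule a qs q w ss f)
  then show ?case by (intro run_Node) (auto simp: trees_over_Node_iff)
qed

text \<open>The children are rewritten from left to right; \<open>ls\<close> holds those already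
  finished.\<close>

lemma steps_children:
  assumes "list_all2 (step M)\<^sup>*\<^sup>* ss ss'"
  shows "(step M)\<^sup>*\<^sup>* (Node a (ls @ ss)) (Node a (ls @ ss'))"
  using assms
proof (induction arbitrary: ls rule: list_all2_induct)
  case (Cons s ss s' ss')
  from Cons(1) have "(step M)\<^sup>*\<^sup>* (Node a (ls @ s # ss)) (Node a (ls @ s' # ss))"
    by induction (auto intro: step.intros rtranclp.rtrancl_into_rtrancl)
  also have "(step M)\<^sup>*\<^sup>* (Node a (ls @ s' # ss)) (Node a (ls @ s' # ss'))"
    using Cons(3)[of "ls @ [s']"] by simp
  finally show ?case .
qed simp

lemma run_steps:
  assumes "bottom_up M" "closed_run M s q t"
  shows "(step M)\<^sup>*\<^sup>* s (Node q [t])"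
  using assms(2)
proof (induction rule: run.induct)
  case (run_Node a qs q w ss f)
  have "(step M)\<^sup>*\<^sup>* (Node a ss) (subst f (lhs a qs))"
    unfolding subst_lhs
    using steps_children[of M ss _ a "[]"] run_Node.IH run_Node.hyps(2)
    by (auto simp: list_all2_conv_all_nth)
  moreover have "step M (subst f (lhs a qs)) (subst f (Node q [w]))"
    using run_Node.hyps(1)
  proof (rule step.intros(1), intro ballI)
    fix i assume "i \<in> set (var_list (lhs a qs))"
    then show "f i \<in> trees (out_alph M)"
      using run_output[OF assms(1) run_Node.hyps(3)[of "i - 1"]] run_Node.hyps(2)
      by (auto simp: var_list_lhs)
  qed
  ultimately show ?case by simp
qed simp

text \<open>Rewriting is eliminated here: from now on transformations are described by runs
  alone.\<close>

lemma realized_iff_run: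
  assumes "bottom_up M"
  shows "(s, t) \<in> realized M \<longleftrightarrow> (\<exists>q \<in> final M. closed_run M s q t)"
proof
  assume "(s, t) \<in> realized M"
  then obtain q where q: "s \<in> trees (in_alph M)" "t \<in> trees (out_alph M)" "q \<in> final M"
    "(step M)\<^sup>*\<^sup>* s (Node q [t])"
    by (auto simp: realized_def)
  from q(4) have "completes M s q t"
  proof (induction rule: converse_rtranclp_induct)
    case base
    then show ?case using q assms by (auto simp: bottom_up_def intro: completes_state)
  qed (rule completes_step[OF assms])
  then show "\<exists>q \<in> final M. closed_run M s q t" using completes_run[OF assms] q by blast
next
  assume "\<exists>q \<in> final M. closed_run M s q t"
  then show "(s, t) \<in> realized M"
    using run_steps[OF assms] closed_run_input[OF assms] run_output[OF assms]
    unfolding realized_def by blast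
qed


subsection \<open>The composite transducer\<close>

text \<open>Used to run the second transducer symbolically on a right hand side of the first.
  Reading a variable stands for having translated the tree below it and ended in the listed state;
  the output variable is a placeholder for that translation. A variable with entry
  \<open>None\<close> cannot be read.\<close>

definition leaf :: "'a option list \<Rightarrow> nat \<Rightarrow> 'a \<Rightarrow> 'a tree \<Rightarrow> bool" where
  "leaf ps i q t \<longleftrightarrow> 1 \<le> i \<and> i \<le> length ps \<and> ps ! (i - 1) = Some q \<and> t = Var i"

text \<open>The option \<open>None\<close> stands for a tree on which \<open>N\<close> has no run. It is needed because
  the first transducer may later delete such a tree; the accompanying output is a dummy.\<close>

definition processes ::
  "'a transducer \<Rightarrow> 'a option list \<Rightarrow> 'a tree \<Rightarrow> 'a option \<Rightarrow> 'a tree \<Rightarrow> bool" where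
  "processes N ps s x t = (case x of
     Some p \<Rightarrow> run N (leaf ps) s p t
   | None \<Rightarrow> t = Node undefined [] \<and> \<not> (\<exists>p t. run N (leaf ps) s p t))"

lemma leaf_Nil: "leaf [] = (\<lambda>_ _ _. False)"
  by (auto simp: leaf_def fun_eq_iff)

lemma processes_Some [simp]: "processes N ps s (Some p) t = run N (leaf ps) s p t"
  by (simp add: processes_def)

lemma processes_None [simp]: "processes N ps s None t \<longleftrightarrow>
    t = Node undefined [] \<and> (\<forall>p t. \<not> run N (leaf ps) s p t)"
  by (auto simp: processes_def)

lemma processes_total: "\<exists>x t. processes N ps s x t"
  by (metis processes_None processes_Some)

text \<open>\<open>None\<close> excludes every \<open>Some\<close> by definition, and its output is
  one fixed dummy; two \<open>Some\<close> results agree by determinism.\<close>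

lemma processes_functional:
  assumes "bottom_up N" "deterministic N" "processes N ps s x t" "processes N ps s x' t'"
  shows "x = x' \<and> t = t'"
proof (cases x; cases x')
  fix p p' assume "x = Some p" "x' = Some p'"
  then show ?thesis
    using assms run_functional[OF assms(1,2), of "leaf ps" s p t p' t'] by (auto simp: leaf_def)
qed (use assms in auto)

lemma finite_processes:
  assumes "bottom_up N"
  shows "finite {(x, t). processes N ps s x t}"
proof -
  have "finite {(q, t). leaf ps i q t}" for i
    by (rule finite_subset[of _ "{(the (ps ! (i - 1)), Var i)}"]) (auto simp: leaf_def)
  then have "finite {(q, t). run N (leaf ps) s q t}" by (rule finite_run[OF assms])
  moreover have "{(x, t). processes N ps s x t} \<subseteq>
      insert (None, Node undefined []) ((\<lambda>(p, t). (Some p, t)) ` {(q, t). run N (leaf ps) s q t})"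
    by (auto simp: processes_def split: option.splits)
  ultimately show ?thesis by (meson finite_imageI finite_insert finite_subset)
qed

text \<open>States and symbols share one type, so pairs of states are encoded injectively by fresh
  symbols. The alphabet \<open>out\<close> gains \<open>undefined\<close> in rank 0 so that the
  dummy output is a legal tree.\<close>

locale composition =
  fixes M N :: "'a transducer" and Q :: "('a \<times> 'a option) set" and code :: "'a \<times> 'a option \<Rightarrow> 'a"
    and out :: "'a ranked"
  assumes M: "bottom_up M" and N: "bottom_up N"
    and Q_def: "Q = states M \<times> insert None (Some ` states N)"
    and out_def: "out = (out_alph N)(0 := insert undefined (out_alph N 0))"
    and inj: "inj_on code Q"
    and fresh: "code ` Q \<inter> (symbols (in_alph M) \<union> symbols out) = {}"
begin

section \<open>Rules of the composite and their finiteness, linearity and determinism\<close>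

definition composite_rules :: "('a tree \<times> 'a tree) set" where
  "composite_rules = {(lhs a (map code zs), Node (code (q, x)) [t]) | a zs q x t w.
     (lhs a (map fst zs), Node q [w]) \<in> rules M \<and> set zs \<subseteq> Q \<and> (q, x) \<in> Q \<and>
     processes N (map snd zs) w x t}"

definition composite :: "'a transducer" where
  "composite = \<lparr>states = code ` Q, in_alph = in_alph M, out_alph = out,
     rules = composite_rules, final = code ` (final M \<times> Some ` final N)\<rparr>"

lemma composite_simps [simp]:
  "states composite = code ` Q" "in_alph composite = in_alph M" "out_alph composite = out"
  "rules composite = composite_rules" "final composite = code ` (final M \<times> Some ` final N)"
  by (simp_all add: composite_def)

lemma finite_Q: "finite Q"
  using M N by (simp add: Q_def bottom_up_def)

lemma final_subset: "final M \<times> Some ` final N \<subseteq> Q"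
  using M N by (auto simp: Q_def bottom_up_def)

lemma composite_rulesE:
  assumes "(lhs a qs, Node r [t]) \<in> composite_rules"
  obtains zs q x w where "qs = map code zs" "r = code (q, x)"
    "(lhs a (map fst zs), Node q [w]) \<in> rules M" "set zs \<subseteq> Q" "(q, x) \<in> Q"
    "processes N (map snd zs) w x t"
proof -
  obtain b zs q x t' w where "lhs a qs = lhs b (map code zs)" "Node r [t] = Node (code (q, x)) [t']"
    "(lhs b (map fst zs), Node q [w]) \<in> rules M" "set zs \<subseteq> Q" "(q, x) \<in> Q"
    "processes N (map snd zs) w x t'"
    using assms unfolding composite_rules_def by blast
  then show thesis
    using that[of zs q x w] by (simp add: lhs_eq_iff)
qed

lemma processes_output:
  assumes "processes N ps w x t"
  shows "t \<in> trees_over out (length ps)"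
proof (cases x)
  case None
  then show ?thesis using assms by (auto simp: trees_over_Node_iff out_def)
next
  case (Some p)
  then have "t \<in> trees_over (out_alph N) (length ps)"
    using assms run_output[OF N, of "leaf ps" w p t] by (simp add: leaf_def trees_over.intros(1))
  then show ?thesis by (rule trees_over_mono) (auto simp: out_def)
qed

text \<open>A rule is determined by a rule of \<open>M\<close>, a list of state pairs of matching
  length and a result of \<open>processes\<close>; each ranges over a finite set.\<close>

lemma finite_composite_rules: "finite composite_rules"
proof -
  let ?arity = "\<lambda>v :: 'a tree. case v of Node a ss \<Rightarrow> length ss"
  let ?body = "\<lambda>y :: 'a tree. case y of Node q [w] \<Rightarrow> w"
  let ?rule = "\<lambda>m zs (x, t). case m of (Node a _, Node q _) \<Rightarrow>
    (lhs a (map code zs), Node (code (q, x)) [t])"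
  let ?R = "\<Union>m \<in> rules M. \<Union>zs \<in> {zs. set zs \<subseteq> Q \<and> length zs = ?arity (fst m)}.
    ?rule m zs ` {(x, t). processes N (map snd zs) (?body (snd m)) x t}"
  have "composite_rules \<subseteq> ?R"
  proof
    fix r assume "r \<in> composite_rules"
    then obtain a zs q x t w where r: "r = (lhs a (map code zs), Node (code (q, x)) [t])"
      "(lhs a (map fst zs), Node q [w]) \<in> rules M" "set zs \<subseteq> Q" "processes N (map snd zs) w x t"
      unfolding composite_rules_def by blast
    let ?m = "(lhs a (map fst zs), Node q [w])"
    have zs: "zs \<in> {zs. set zs \<subseteq> Q \<and> length zs = ?arity (fst ?m)}"
      using r by (simp add: lhs_def)
    have "r = ?rule ?m zs (x, t)" using r by (simp add: lhs_def)
    then have "r \<in> ?rule ?m zs ` {(x, t). processes N (map snd zs) (?body (snd ?m)) x t}"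
      by (rule image_eqI) (use r in simp)
    with zs show "r \<in> ?R" by (intro UN_I[OF r(2)] UN_I[of zs])
  qed
  moreover have "finite (rules M)" using M by (simp add: bottom_up_def)
  then have "finite ?R"
    using finite_lists_length_eq[OF finite_Q] finite_processes[OF N] by auto
  ultimately show ?thesis by (rule finite_subset)
qed

lemma bottom_up_composite: "bottom_up composite"
  unfolding bottom_up_def composite_simps
proof (intro conjI)
  show "ranked_alphabet (in_alph M)" using M by (simp add: bottom_up_def)
  have alph: "ranked_alphabet (out_alph N)" using N by (simp add: bottom_up_def)
  have "symbols out \<subseteq> insert undefined (symbols (out_alph N))"
    "{k. out k \<noteq> {}} \<subseteq> insert 0 {k. out_alph N k \<noteq> {}}"
    by (auto simp: symbols_def out_def split: if_splits)
  then show "ranked_alphabet out"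
    using alph unfolding ranked_alphabet_def by (meson finite_insert finite_subset)
  show "composite_rules \<subseteq> {(lhs a qs, Node q [t]) | a qs q t.
      a \<in> in_alph M (length qs) \<and> set qs \<subseteq> code ` Q \<and> q \<in> code ` Q \<and>
      t \<in> trees_over out (length qs)}"
  proof
    fix r assume "r \<in> composite_rules"
    then obtain a zs q x t w where r: "r = (lhs a (map code zs), Node (code (q, x)) [t])"
      "(lhs a (map fst zs), Node q [w]) \<in> rules M" "set zs \<subseteq> Q" "(q, x) \<in> Q"
      "processes N (map snd zs) w x t"
      unfolding composite_rules_def by blast
    have "a \<in> in_alph M (length (map code zs))" using bottom_up_ruleD(1)[OF M r(2)] by simp
    moreover have "t \<in> trees_over out (length (map code zs))" using processes_output[OF r(5)] by simp
    moreover have "set (map code zs) \<subseteq> code ` Q" using r by auto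
    ultimately show "r \<in> {(lhs a qs, Node q [t]) | a qs q t.
        a \<in> in_alph M (length qs) \<and> set qs \<subseteq> code ` Q \<and> q \<in> code ` Q \<and>
        t \<in> trees_over out (length qs)}"
      using r by blast
  qed
qed (use finite_Q fresh finite_composite_rules image_mono[OF final_subset] in simp_all)

lemma linear_composite:
  assumes "linear M" "linear N"
  shows "linear composite"
  unfolding linear_def
proof clarify
  fix v y assume "(v, y) \<in> rules composite"
  then obtain a zs q x t w where r: "y = Node (code (q, x)) [t]"
    "(lhs a (map fst zs), Node q [w]) \<in> rules M" "processes N (map snd zs) w x t"
    unfolding composite_simps composite_rules_def by blast
  have "distinct (var_list w)" using assms(1) r(2) unfolding linear_def by fastforce
  then have "distinct (var_list t)"
    using r(3) run_linear[OF N assms(2), of "leaf (map snd zs)" w _ t]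
    by (cases x) (auto simp: leaf_def)
  then show "distinct (var_list y)" using r by simp
qed

text \<open>Injectivity of \<open>code\<close> recovers the state pairs from the left hand side.
  They fix the rule of \<open>M\<close>, and \<open>processes_functional\<close> fixes the
  rest.\<close>

lemma deterministic_composite:
  assumes "deterministic M" "deterministic N"
  shows "deterministic composite"
  unfolding deterministic_def composite_simps
proof (intro ballI impI notI)
  fix r r' assume r: "r \<in> composite_rules" "r' \<in> composite_rules" "r \<noteq> r'" "fst r = fst r'"
  from r(1) obtain a zs q x t w where 1: "r = (lhs a (map code zs), Node (code (q, x)) [t])"
    "(lhs a (map fst zs), Node q [w]) \<in> rules M" "set zs \<subseteq> Q" "processes N (map snd zs) w x t"
    unfolding composite_rules_def by blast
  from r(2) obtain a' zs' q' x' t' w' where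
    2: "r' = (lhs a' (map code zs'), Node (code (q', x')) [t'])"
    "(lhs a' (map fst zs'), Node q' [w']) \<in> rules M" "set zs' \<subseteq> Q"
    "processes N (map snd zs') w' x' t'"
    unfolding composite_rules_def by blast
  have "a = a'" "map code zs = map code zs'" using r(4) 1 2 by (auto simp: lhs_eq_iff)
  moreover have "zs = zs'"
    using \<open>map code zs = map code zs'\<close> 1(3) 2(3)
    by (meson inj inj_on_subset inj_on_map_eq_map le_sup_iff)
  ultimately have "q = q'" "w = w'"
    using 1(2) 2(2) assms(1) unfolding deterministic_def by fastforce+
  then have "x = x'" "t = t'"
    using processes_functional[OF N assms(2) 1(4)] 2(4) \<open>zs = zs'\<close> by auto
  then show False using 1 2 r(3) \<open>q = q'\<close> \<open>a = a'\<close> \<open>zs = zs'\<close> by simp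
qed

text \<open>A composite run handles all copies of an intermediate subtree alike, which is one of the
  ways open to \<open>N\<close>. For \<open>x = None\<close> only the run of \<open>M\<close> is
  claimed.\<close>

lemma composite_sound:
  assumes "closed_run composite s r t" "r = code (q, x)" "(q, x) \<in> Q"
  shows "\<exists>u. closed_run M s q u \<and> (\<forall>p. x = Some p \<longrightarrow> closed_run N u p t)"
  using assms
proof (induction arbitrary: q x rule: run.induct)
  case (run_Node a qs r t' ss f)
  from run_Node.hyps(1) obtain zs q' x' w where r: "qs = map code zs" "r = code (q', x')"
    "(lhs a (map fst zs), Node q' [w]) \<in> rules M" "set zs \<subseteq> Q" "(q', x') \<in> Q"
    "processes N (map snd zs) w x' t'"
    unfolding composite_simps by (rule composite_rulesE)
  have qx: "q' = q" "x' = x" using inj run_Node.prems r by (auto dest: inj_onD)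
  have len: "length zs = length ss" using r run_Node.hyps(2) by simp
  have "\<exists>u. closed_run M (ss ! i) (fst (zs ! i)) u \<and>
      (\<forall>p. snd (zs ! i) = Some p \<longrightarrow> closed_run N u p (f (Suc i)))" if "i < length ss" for i
  proof (rule run_Node.IH[OF that])
    have "zs ! i \<in> Q" using that len r(4) nth_mem[of i zs] by auto
    then show "(fst (zs ! i), snd (zs ! i)) \<in> Q" by simp
    show "qs ! i = code (fst (zs ! i), snd (zs ! i))" using that len r(1) by simp
  qed
  then obtain U where U: "\<And>i. i < length ss \<Longrightarrow> closed_run M (ss ! i) (fst (zs ! i)) (U i)"
    "\<And>i p. i < length ss \<Longrightarrow> snd (zs ! i) = Some p \<Longrightarrow> closed_run N (U i) p (f (Suc i))"
    by metis
  let ?U = "\<lambda>i. U (i - 1)"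
  have "closed_run M (Node a ss) q (subst ?U w)"
    using r(3) qx len U(1) by (intro run.run_Node) auto
  moreover have "closed_run N (subst ?U w) p (subst f t')" if "x = Some p" for p
  proof (rule run_subst)
    show "run N (leaf (map snd zs)) w p t'" using r(6) that qx by simp
  next
    fix i p u assume "leaf (map snd zs) i p u"
    then show "closed_run N (?U i) p (subst f u)"
      using U(2)[of "i - 1" p] len by (auto simp: leaf_def)
  qed
  ultimately show ?case by blast
qed simp

lemma processes_state: "processes N [] s x t \<Longrightarrow> x \<in> insert None (Some ` states N)"
  by (cases x) (auto simp: leaf_Nil dest: run_state[OF N])

text \<open>Assembles the state pairs of a composite rule from the states \<open>qs\<close> of
  \<open>M\<close> and results \<open>X\<close>, \<open>T\<close> of \<open>N\<close> indexed by
  variables.\<close>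

lemma composite_step:
  assumes rule: "(lhs a qs, Node q [w]) \<in> rules M" and len: "length qs = length ss"
    and runs: "\<And>i. i < length ss \<Longrightarrow> closed_run composite (ss ! i) (code (qs ! i, X (Suc i))) (T (Suc i))"
    and X: "\<And>i. i < length ss \<Longrightarrow> X (Suc i) \<in> insert None (Some ` states N)"
    and x: "x \<in> insert None (Some ` states N)"
    and t: "processes N (map (\<lambda>i. X (Suc i)) [0..<length ss]) w x t"
  shows "closed_run composite (Node a ss) (code (q, x)) (subst T t)"
proof -
  define zs where "zs = map (\<lambda>i. (qs ! i, X (Suc i))) [0..<length ss]"
  have zs: "map fst zs = qs" "map snd zs = map (\<lambda>i. X (Suc i)) [0..<length ss]"
    using len by (auto simp: zs_def map_nth comp_def intro: nth_equalityI)
  note D = bottom_up_ruleD[OF M rule]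
  have "set zs \<subseteq> Q"
  proof
    fix z assume "z \<in> set zs"
    then obtain i where "i < length ss" "z = (qs ! i, X (Suc i))" by (auto simp: zs_def)
    then show "z \<in> Q" using X[of i] D(2) len nth_mem[of i qs] by (auto simp: Q_def)
  qed
  moreover have "(q, x) \<in> Q" using D(3) x by (auto simp: Q_def)
  moreover have "(lhs a (map fst zs), Node q [w]) \<in> rules M" "processes N (map snd zs) w x t"
    using rule t by (simp_all add: zs)
  ultimately have "(lhs a (map code zs), Node (code (q, x)) [t]) \<in> rules composite"
    unfolding composite_simps composite_rules_def by blast
  then show ?thesis
    by (rule run_Node) (use runs in \<open>auto simp: zs_def\<close>)
qed

text \<open>Induction on the run of \<open>M\<close>, for all results of \<open>N\<close> on its
  output at once: the result required at a child depends on how the parent uses it.\<close>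

lemma composite_complete:
  assumes "linear M \<or> deterministic N" "closed_run M s q u" "processes N [] u x t"
  shows "closed_run composite s (code (q, x)) t"
  using assms(2,3)
proof (induction arbitrary: x t rule: run.induct)
  case (run_Node a qs q w ss U)
  note step = composite_step[OF run_Node.hyps(1,2)]
  have vars: "\<exists>j < length ss. i = Suc j" if "i \<in> set (var_list w)" for i
    using rule_vars[OF M run_Node.hyps(1) that] run_Node.hyps(2) by metis
  show ?case
  proof (cases x)
    case None
    have "\<exists>x t. processes N [] (U i) x t" for i by (rule processes_total)
    then obtain X T where XT: "\<And>i. processes N [] (U i) (X i) (T i)" by metis
    let ?xs = "map (\<lambda>i. X (Suc i)) [0..<length ss]"
    \<comment> \<open>A symbolic run on \<open>w\<close>, filled with the runs chosen for the
      children, would be a run of \<open>N\<close> on the whole intermediate tree.\<close>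
    have "\<not> run N (leaf ?xs) w p t'" for p t'
    proof
      assume "run N (leaf ?xs) w p t'"
      then have "run N (leaf []) (subst U w) p (subst T t')"
      proof (rule run_subst)
        fix i r u assume "leaf ?xs i r u"
        then show "run N (leaf []) (U i) r (subst T u)"
          using XT[of i] by (auto simp: leaf_def)
      qed
      then show False using None run_Node.prems by simp
    qed
    then have "closed_run composite (Node a ss) (code (q, None)) (subst T (Node undefined []))"
      using run_Node.IH[OF _ XT] processes_state[OF XT] by (intro step[where X = X]) simp_all
    then show ?thesis using None run_Node.prems by simp
  next
    case (Some p)
    have "run N (leaf []) (subst U w) p t" using run_Node.prems Some by simp
    moreover have "distinct (var_list w)" if "linear M"
      using that run_Node.hyps(1) unfolding linear_def by fastforce
    then have "distinct (var_list w) \<or> (\<forall>i r u r' u'.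
        run N (leaf []) (U i) r u \<longrightarrow> run N (leaf []) (U i) r' u' \<longrightarrow> r = r' \<and> u = u')"
      using assms(1) run_functional[OF N, of "leaf []"] by (auto simp: leaf_def)
    ultimately obtain P H t' where PH:
      "\<And>i. i \<in> set (var_list w) \<Longrightarrow> run N (leaf []) (U i) (P i) (H i)"
      "run N (\<lambda>i r u. r = P i \<and> u = Var i) w p t'" "t = subst H t'"
      using run_substE[OF N, of "leaf []" U w p t] by blast
    \<comment> \<open>For variables of \<open>w\<close> the result is dictated by the run of
      \<open>N\<close>. A deleted child may get any result, including \<open>None\<close> if
      \<open>N\<close> has no run there.\<close>
    have "\<exists>x t. processes N [] (U i) x t \<and> (i \<in> set (var_list w) \<longrightarrow> x = Some (P i) \<and> t = H i)"
      for i
    proof (cases "i \<in> set (var_list w)")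
      case True
      then show ?thesis using PH(1)[of i] by (metis processes_Some)
    qed (use processes_total in blast)
    then obtain X T where XT: "\<And>i. processes N [] (U i) (X i) (T i)"
      "\<And>i. i \<in> set (var_list w) \<Longrightarrow> X i = Some (P i) \<and> T i = H i"
      by metis
    let ?xs = "map (\<lambda>i. X (Suc i)) [0..<length ss]"
    have "run N (leaf ?xs) w p t'"
      using PH(2)
    proof (rule run_cong)
      fix i r and u :: "'a tree" assume i: "i \<in> set (var_list w)" and "r = P i \<and> u = Var i"
      moreover obtain j where "j < length ss" "i = Suc j" using vars[OF i] by blast
      ultimately show "leaf ?xs i r u" using XT(2)[OF i] by (simp add: leaf_def)
    qed
    then have "closed_run composite (Node a ss) (code (q, Some p)) (subst T t')"
      using run_Node.IH[OF _ XT(1)] processes_state[OF XT(1)] processes_state[OF run_Node.prems] Some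
      by (intro step[where X = X]) simp_all
    \<comment> \<open>\<open>T\<close> agrees with \<open>H\<close> on the variables of
      \<open>w\<close>, and the symbolic output contains no others.\<close>
    moreover have "set (var_list t') \<subseteq> set (var_list w)"
      using run_vars[OF N PH(2)] by simp
    then have "subst T t' = t"
      unfolding PH(3) using XT(2) by (intro subst_cong) auto
    ultimately show ?thesis using Some by simp
  qed
qed simp

lemma realized_composite:
  assumes "linear M \<or> deterministic N"
  shows "realized composite = realized M O realized N"
proof (rule set_eqI, rule iffI; clarify)
  fix s t assume "(s, t) \<in> realized composite"
  then obtain q p where qp: "q \<in> final M" "p \<in> final N" "closed_run composite s (code (q, Some p)) t"
    unfolding realized_iff_run[OF bottom_up_composite] by auto
  moreover have "(q, Some p) \<in> Q" using qp final_subset by auto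
  ultimately obtain u where "closed_run M s q u" "closed_run N u p t"
    using composite_sound by blast
  then show "(s, t) \<in> realized M O realized N"
    using qp realized_iff_run[OF M] realized_iff_run[OF N] by blast
next
  fix s u t assume "(s, u) \<in> realized M" "(u, t) \<in> realized N"
  then obtain q p where qp: "q \<in> final M" "p \<in> final N" "closed_run M s q u" "closed_run N u p t"
    using realized_iff_run[OF M] realized_iff_run[OF N] by blast
  then have "closed_run composite s (code (q, Some p)) t"
    using composite_complete[OF assms qp(3), of "Some p" t] by (simp add: leaf_Nil)
  then show "(s, t) \<in> realized composite"
    using qp unfolding realized_iff_run[OF bottom_up_composite] by auto
qed

end

text \<open>One composite serves all four inclusions. The infinite type supplies enough symbols
  outside the finite alphabets to name its states.\<close>

lemma composition_exists:
  fixes M N :: "'a::infinite transducer"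
  assumes "bottom_up M" "bottom_up N" "linear M \<or> deterministic N"
  shows "\<exists>C. bottom_up C \<and> realized C = realized M O realized N \<and>
    (linear M \<longrightarrow> linear N \<longrightarrow> linear C) \<and>
    (deterministic M \<longrightarrow> deterministic N \<longrightarrow> deterministic C)"
proof -
  define Q where "Q = states M \<times> insert None (Some ` states N)"
  define out where "out = (out_alph N)(0 := insert undefined (out_alph N 0))"
  let ?F = "symbols (in_alph M) \<union> symbols out"
  have "symbols out \<subseteq> insert undefined (symbols (out_alph N))"
    by (auto simp: symbols_def out_def split: if_splits)
  then have "finite ?F" and Q: "finite Q"
    using assms finite_subset by (auto simp: bottom_up_def ranked_alphabet_def Q_def)
  then have "infinite (- ?F)"
    unfolding Compl_eq_Diff_UNIV by (intro Diff_infinite_finite infinite_UNIV)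
  then obtain T where T: "finite T" "card T = card Q" "T \<subseteq> - ?F"
    using infinite_arbitrarily_large by metis
  then obtain code where code: "bij_betw code Q T"
    using Q finite_same_card_bij by metis
  have "inj_on code Q" "code ` Q \<inter> ?F = {}"
    using bij_betw_imp_inj_on[OF code] bij_betw_imp_surj_on[OF code] T(3) by auto
  then interpret composition M N Q code out
    using assms(1,2) by unfold_locales (simp_all add: Q_def out_def)
  show ?thesis
    using bottom_up_composite realized_composite[OF assms(3)] linear_composite
      deterministic_composite by blast
qed

theorem theorem4p57:
  shows "((LB :: 'a::infinite transformation set) \<odot> B \<subseteq> B \<and>
          (LB :: 'a transformation set) \<odot> LB \<subseteq> LB) \<and>
         ((B :: 'a transformation set) \<odot> DB \<subseteq> B \<and>
          (DB :: 'a transformation set) \<odot> DB \<subseteq> DB)"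
proof (intro conjI subsetI)
  fix x :: "'a transformation" assume "x \<in> LB \<odot> B"
  then show "x \<in> B"
    unfolding compose_classes_def LB_def B_def using composition_exists by blast
next
  fix x :: "'a transformation" assume "x \<in> LB \<odot> LB"
  then obtain M N where "x = realized M O realized N" "bottom_up M" "linear M" "bottom_up N" "linear N"
    unfolding compose_classes_def LB_def by blast
  then show "x \<in> LB" unfolding LB_def using composition_exists[of M N] by blast
next
  fix x :: "'a transformation" assume "x \<in> B \<odot> DB"
  then show "x \<in> B"
    unfolding compose_classes_def DB_def B_def using composition_exists by blast
next
  fix x :: "'a transformation" assume "x \<in> DB \<odot> DB"
  then obtain M N where "x = realized M O realized N" "bottom_up M" "deterministic M"
    "bottom_up N" "deterministic N"
    unfolding compose_classes_def DB_def by blast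
  then show "x \<in> DB" unfolding DB_def using composition_exists[of M N] by blast
qed

end
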